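(* Let $m,n$ be positive integers. For every matrix $(a_{ij})\in\mathbb{R}^{m\times n}$ there exists a unique polynomial $p\in{}_{n}^{1}\Pi_{mn-1}^{2}$ such that $p(i,j)=a_{ij}$ for all $(i,j)\in\{1,\ldots,m\}\times\{1,\ldots,n\}$, and it is given by $$p(x,y)=\sum_{k=0}^{mn-1}\binom{(nx+y)-(n+1)}{k}\Delta^k\widetilde a_1,$$ where $\widetilde a_1,\widetilde a_2,\ldots,\widetilde a_{mn}$ is the sequence defined by $\widetilde a_{(i-1)n+j}=a_{ij}$ for $i=1,\ldots,m$ and $j=1,\ldots,n$, and $\Delta^k\widetilde a_1$ is the $k$th Newton forward difference of $\widetilde a_1$ for this sequence.
   Context: ${}_{n}^{1}\Pi_{mn-1}^{2}$ denotes the space of all bivariate real polynomials of the form $p(x,y)=\sum_{k=0}^{mn-1}\lambda_k(nx+y)^k$ with $\lambda_k\in\mathbb{R}$. Forward differences: $\Delta^0\widetilde a_l=\widetilde a_l$ and $\Delta^{k}\widetilde a_l=\Delta^{k-1}\widetilde a_{l+1}-\Delta^{k-1}\widetilde a_l$. For a polynomial argument $z$ and integer $k\ge0$, $\binom{z}{k}=\frac{z(z-1)\cdots(z-k+1)}{k!}$, with $\binom{z}{0}=1$. *)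

theory Defs
  imports Complex_Main "HOL-Computational_Algebra.Polynomial"
begin

text \<open>
  A bivariate real polynomial is an element of \<open>\<real>[x][y]\<close>: the outer variable of
  \<^typ>\<open>real poly poly\<close> is \<open>y\<close>, the inner one is \<open>x\<close>.
\<close>

definition eval_xy :: "real poly poly \<Rightarrow> real \<Rightarrow> real \<Rightarrow> real" where
  "eval_xy p x y = poly (poly p [:y:]) x"

text \<open>The linear polynomial \<open>n x + y\<close>.\<close>

definition ridge_lin :: "nat \<Rightarrow> real poly poly" where
  "ridge_lin n = [:[:0, real n:], 1:]"

definition ridge_space :: "nat \<Rightarrow> nat \<Rightarrow> real poly poly set" where
  "ridge_space n N = {p. \<exists>c :: nat \<Rightarrow> real. p = (\<Sum>k=0..N. smult [:c k:] (ridge_lin n ^ k))}"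

lemma eval_xy_ridge:
  "eval_xy (\<Sum>k=0..N. smult [:c k:] (ridge_lin n ^ k)) x y = (\<Sum>k=0..N. c k * (real n * x + y) ^ k)"
  by (simp add: eval_xy_def ridge_lin_def poly_sum algebra_simps)

primrec fwd_diff :: "nat \<Rightarrow> (nat \<Rightarrow> real) \<Rightarrow> nat \<Rightarrow> real" where
  "fwd_diff 0 s l = s l"
| "fwd_diff (Suc k) s l = fwd_diff k s (l + 1) - fwd_diff k s l"

text \<open>
  \<open>s\<close> lists the \<open>m \<times> n\<close> matrix \<open>a\<close> (indexed from 1) row by row, also from index 1;
  values of \<open>a\<close> and \<open>s\<close> outside these ranges are irrelevant.
\<close>

definition row_listing :: "nat \<Rightarrow> nat \<Rightarrow> (nat \<Rightarrow> nat \<Rightarrow> real) \<Rightarrow> (nat \<Rightarrow> real) \<Rightarrow> bool" where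
  "row_listing m n a s \<longleftrightarrow> (\<forall>i\<in>{1..m}. \<forall>j\<in>{1..n}. s ((i - 1) * n + j) = a i j)"

lemma row_listing_exists: "\<exists>s. row_listing m n a s"
proof
  let ?s = "\<lambda>l. a ((l - 1) div n + 1) ((l - 1) mod n + 1)"
  show "row_listing m n a ?s"
    unfolding row_listing_def
  proof (intro ballI)
    fix i j assume i: "i \<in> {1..m}" and j: "j \<in> {1..n}"
    obtain i' j' where ij: "i = Suc i'" "j = Suc j'"
      using i j by (cases i; cases j) auto
    then have "j' < n" using j by simp
    then show "?s ((i - 1) * n + j) = a i j"
      by (simp add: ij)
  qed
qed

definition interpolates :: "nat \<Rightarrow> nat \<Rightarrow> (nat \<Rightarrow> nat \<Rightarrow> real) \<Rightarrow> real poly poly \<Rightarrow> bool" where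
  "interpolates m n a p \<longleftrightarrow> (\<forall>i\<in>{1..m}. \<forall>j\<in>{1..n}. eval_xy p (real i) (real j) = a i j)"

end

theory Submission
  imports Defs
begin

text \<open>
  A polynomial in the ridge space has the form \<open>q(n x + y)\<close> with \<open>q\<close> univariate of degree at
  most \<open>m n - 1\<close>, and \<open>(i, j) \<mapsto> n i + j\<close> maps the grid bijectively onto the consecutive
  integers \<open>n + 1, \<dots>, n + m n\<close>. So the problem is univariate interpolation at equidistant
  nodes: \<open>q\<close> is unique because a nonzero polynomial has at most as many roots as its degree,
  and it is given by Newton's forward difference formula.
\<close>

text \<open>For \<open>degree q \<le> N\<close> this is \<open>q\<close> with \<open>n x + y\<close>
  substituted for its variable. Summing to the fixed bound \<open>N\<close> matches the shape of
  \<open>ridge_space\<close>; the extra coefficients are zero.\<close>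

definition ridge_lift :: "nat \<Rightarrow> nat \<Rightarrow> real poly \<Rightarrow> real poly poly" where
  "ridge_lift n N q = (\<Sum>k=0..N. smult [:coeff q k:] (ridge_lin n ^ k))"

lemma eval_xy_ridge_lift:
  assumes "degree q \<le> N"
  shows "eval_xy (ridge_lift n N q) x y = poly q (real n * x + y)"
proof -
  have "poly q z = (\<Sum>k\<le>N. coeff q k * z ^ k)" for z
    by (subst poly_as_sum_of_monoms'[OF assms, symmetric]) (simp add: poly_sum poly_monom)
  then show ?thesis
    by (simp add: ridge_lift_def eval_xy_ridge atMost_atLeast0)
qed

lemma ridge_space_eq: "ridge_space n N = ridge_lift n N ` {q. degree q \<le> N}"
proof (intro equalityI subsetI)
  fix p assume "p \<in> ridge_space n N"
  then obtain c where c: "p = (\<Sum>k=0..N. smult [:c k:] (ridge_lin n ^ k))"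
    by (auto simp: ridge_space_def)
  let ?q = "\<Sum>k\<le>N. monom (c k) k"
  have "coeff ?q k = c k" if "k \<le> N" for k
    using that by (simp add: coeff_sum)
  then have "p = ridge_lift n N ?q"
    by (simp add: c ridge_lift_def)
  moreover have "degree ?q \<le> N"
    by (intro degree_sum_le) (auto intro: order_trans[OF degree_monom_le])
  ultimately show "p \<in> ridge_lift n N ` {q. degree q \<le> N}"
    by blast
qed (auto simp: ridge_space_def ridge_lift_def)

text \<open>Pascal's rule, followed by an index shift in one of the two resulting sums.\<close>

lemma sum_binomial_Suc:
  fixes f :: "nat \<Rightarrow> real"
  shows "(\<Sum>k\<le>Suc r. real (Suc r choose k) * f k) =
    (\<Sum>k\<le>r. real (r choose k) * (f k + f (Suc k)))"
proof -
  have "(\<Sum>k\<le>Suc r. real (Suc r choose k) * f k) =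
      (\<Sum>k\<le>r. real (r choose k) * f (Suc k)) + (f 0 + (\<Sum>k\<le>r. real (r choose Suc k) * f (Suc k)))"
    by (simp add: sum.atMost_Suc_shift sum.distrib algebra_simps del: sum.atMost_Suc)
  also have "f 0 + (\<Sum>k\<le>r. real (r choose Suc k) * f (Suc k)) = (\<Sum>k\<le>Suc r. real (r choose k) * f k)"
    by (simp add: sum.atMost_Suc_shift del: sum.atMost_Suc)
  \<comment> \<open>The top term vanishes because \<open>r choose Suc r\<close> is 0.\<close>
  also have "\<dots> = (\<Sum>k\<le>r. real (r choose k) * f k)"
    by simp
  finally show ?thesis
    by (simp add: sum.distrib algebra_simps)
qed

text \<open>The shift operator is the identity plus the difference operator, and its
  \<open>r\<close>-th power expands binomially. The induction leaves \<open>l\<close> arbitrary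
  because its step uses the hypothesis at \<open>l + 1\<close>.\<close>

lemma newton_forward_difference:
  "s (l + r) = (\<Sum>k\<le>r. real (r choose k) * fwd_diff k s l)"
proof (induction r arbitrary: l)
  case (Suc r)
  have "s (l + Suc r) = (\<Sum>k\<le>r. real (r choose k) * fwd_diff k s (l + 1))"
    using Suc[of "l + 1"] by simp
  then show ?case
    unfolding sum_binomial_Suc by simp
qed simp

text \<open>Newton's interpolation polynomial for the values \<open>s l\<close>, ...,
  \<open>s (l + N)\<close> at the nodes \<open>b\<close>, ..., \<open>b + N\<close>. The products
  divided by \<open>fact k\<close> are the binomials of \<open>z - b\<close> over \<open>k\<close>,
  written as polynomials so that their degree can be bounded.\<close>

definition newton_poly :: "real \<Rightarrow> nat \<Rightarrow> (nat \<Rightarrow> real) \<Rightarrow> nat \<Rightarrow> real poly" where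
  "newton_poly b N s l =
    (\<Sum>k=0..N. smult (fwd_diff k s l / fact k) (\<Prod>i<k. [:- b - real i, 1:]))"

lemma poly_newton_poly:
  "poly (newton_poly b N s l) z = (\<Sum>k=0..N. ((z - b) gchoose k) * fwd_diff k s l)"
  by (simp add: newton_poly_def poly_sum poly_prod gbinomial_prod_rev atLeast0LessThan
      algebra_simps)

lemma degree_newton_poly: "degree (newton_poly b N s l) \<le> N"
proof -
  have "degree (\<Prod>i<k. [:- b - real i, 1:]) \<le> k" for k
    by (rule order_trans[OF degree_prod_sum_le]) simp_all
  then show ?thesis
    unfolding newton_poly_def
    by (intro degree_sum_le) (auto intro: order_trans[OF degree_smult_le] order_trans)
qed

lemma poly_newton_poly_node:
  assumes "r \<le> N"
  shows "poly (newton_poly b N s l) (b + real r) = s (l + r)"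
proof -
  have "poly (newton_poly b N s l) (b + real r) = (\<Sum>k\<le>N. real (r choose k) * fwd_diff k s l)"
    by (simp add: poly_newton_poly binomial_gbinomial atMost_atLeast0)
  \<comment> \<open>Terms with \<open>k > r\<close> drop out, since \<open>r choose k\<close> is
    then 0.\<close>
  also have "\<dots> = (\<Sum>k\<le>r. real (r choose k) * fwd_diff k s l)"
    using assms by (intro sum.mono_neutral_right) auto
  finally show ?thesis
    by (simp add: newton_forward_difference)
qed

lemma grid_index_less:
  fixes i j m n :: nat
  assumes "i \<in> {1..m}" and "j \<in> {1..n}"
  shows "(i - 1) * n + (j - 1) < m * n"
proof -
  have "(i - 1) * n + (j - 1) < (i - 1) * n + n"
    using assms by auto
  also have "\<dots> = i * n"
    using assms by (cases i) auto
  also have "\<dots> \<le> m * n"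
    using assms by simp
  finally show ?thesis .
qed

text \<open>The base point \<open>n + 1\<close> is the value of \<open>n x + y\<close> at (1, 1);
  the rest is the row-by-row position counted from 0.\<close>

lemma grid_node:
  assumes "i \<in> {1..m}" and "j \<in> {1..n}"
  shows "real n * real i + real j = real n + 1 + real ((i - 1) * n + (j - 1))"
  using assms by (cases i; cases j) (auto simp: algebra_simps)

lemma interpolates_newton:
  assumes s: "row_listing m n a s"
  shows "interpolates m n a (ridge_lift n (m * n - 1) (newton_poly (real n + 1) (m * n - 1) s 1))"
  unfolding interpolates_def
proof (intro ballI)
  fix i j assume ij: "i \<in> {1..m}" "j \<in> {1..n}"
  have "(i - 1) * n + (j - 1) \<le> m * n - 1"
    using grid_index_less[OF ij] by linarith
  \<comment> \<open>Positions count from 0, whereas \<open>s\<close> is indexed from 1.\<close>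
  moreover have "1 + ((i - 1) * n + (j - 1)) = (i - 1) * n + j"
    using ij by auto
  ultimately show "eval_xy (ridge_lift n (m * n - 1) (newton_poly (real n + 1) (m * n - 1) s 1))
      (real i) (real j) = a i j"
    using s ij poly_newton_poly_node[of "(i - 1) * n + (j - 1)" "m * n - 1" "real n + 1" s 1]
    by (simp add: eval_xy_ridge_lift degree_newton_poly grid_node[OF ij] row_listing_def
        del: of_nat_add of_nat_mult)
qed

lemma interpolates_unique:
  assumes "m > 0" and "n > 0"
    and p: "p \<in> ridge_space n (m * n - 1)" "interpolates m n a p"
    and p': "p' \<in> ridge_space n (m * n - 1)" "interpolates m n a p'"
  shows "p = p'"
proof -
  let ?N = "m * n - 1"
  obtain q q' where q: "p = ridge_lift n ?N q" "degree q \<le> ?N"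
    and q': "p' = ridge_lift n ?N q'" "degree q' \<le> ?N"
    using p(1) p'(1) by (auto simp: ridge_space_eq)
  let ?A = "(\<lambda>r. real n + 1 + real r) ` {..<m * n}"
  have "q = q'"
  proof (rule poly_eqI_degree[where A = ?A])
    have "card ?A = m * n"
      by (subst card_image) (auto simp: inj_on_def)
    \<comment> \<open>Positivity makes the truncated \<open>m * n - 1\<close> strictly smaller than
      the number of nodes.\<close>
    moreover have "m * n > 0"
      using assms(1,2) by simp
    ultimately show "card ?A > degree q" "card ?A > degree q'"
      using q(2) q'(2) by linarith+
    fix z assume "z \<in> ?A"
    then obtain r where r: "r < m * n" "z = real n + 1 + real r"
      by auto
    \<comment> \<open>Division with remainder by \<open>n\<close> inverts the row-by-row numbering,
      so every node comes from a grid point.\<close>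
    define i j where "i = r div n + 1" and "j = r mod n + 1"
    have ij: "i \<in> {1..m}" "j \<in> {1..n}"
      using r(1) \<open>n > 0\<close> by (auto simp: i_def j_def Suc_le_eq less_mult_imp_div_less)
    have "(i - 1) * n + (j - 1) = r"
      by (simp add: i_def j_def)
    then have "z = real n * real i + real j"
      using grid_node[OF ij] r(2) by simp
    then show "poly q z = poly q' z"
      using p(2) p'(2) ij q q' by (simp add: interpolates_def eval_xy_ridge_lift)
  qed
  then show ?thesis
    using q q' by simp
qed

theorem corollary3p15:
  fixes m n :: nat and a :: "nat \<Rightarrow> nat \<Rightarrow> real"
  assumes "m > 0" and "n > 0"
  shows "(\<exists>!p. p \<in> ridge_space n (m * n - 1) \<and> interpolates m n a p) \<and>
    (\<forall>p s. p \<in> ridge_space n (m * n - 1) \<and> interpolates m n a p \<and> row_listing m n a s \<longrightarrow>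
      (\<forall>x y. eval_xy p x y =
        (\<Sum>k=0..m * n - 1. ((real n * x + y - (real n + 1)) gchoose k) * fwd_diff k s 1)))"
proof -
  let ?N = "m * n - 1"
  let ?p = "\<lambda>s. ridge_lift n ?N (newton_poly (real n + 1) ?N s 1)"
  have p: "?p s \<in> ridge_space n ?N" for s
    by (auto simp: ridge_space_eq degree_newton_poly)
  obtain s where "row_listing m n a s"
    using row_listing_exists by blast
  then have "\<exists>!p. p \<in> ridge_space n ?N \<and> interpolates m n a p"
    using p interpolates_newton interpolates_unique[OF assms] by blast
  moreover have "eval_xy p x y =
      (\<Sum>k=0..?N. ((real n * x + y - (real n + 1)) gchoose k) * fwd_diff k s 1)"
    if "p \<in> ridge_space n ?N" "interpolates m n a p" "row_listing m n a s" for p s x y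
  proof -
    \<comment> \<open>\<open>?p s\<close> interpolates for any listing \<open>s\<close>, so
      uniqueness identifies it with \<open>p\<close>.\<close>
    have "p = ?p s"
      using that p interpolates_newton interpolates_unique[OF assms] by blast
    then show ?thesis
      by (simp only: eval_xy_ridge_lift[OF degree_newton_poly] poly_newton_poly)
  qed
  ultimately show ?thesis
    by blast
qed

end
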